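(* Let $X$ be a Banach space with a normalized $1$-unconditional basis that is self-similar, in the sense that $M_X\sim M_Y$ for all subspaces $Y\subset X$ generated by a disjoint sequence, and such that $\lim_{n\to\infty}M_X(n)=\infty$. Let $\phi:[0,+\infty)\to\mathbb C$ be an expansive Lipschitz function. Then the Kalton--Peck map $\mathscr K_\phi(x)=x\,\phi\left(-\log\frac{|x|}{\|x\|}\right)$ on $X$ is singular.
   Context: $X$ is viewed, via its basis, as a Banach lattice of scalar sequences (complex scalars), so $|x|$, products and supports are coordinatewise. $\mathscr K_\phi(x)$ is the sequence with $n$-th coordinate $x_n\phi(-\log(|x_n|/\|x\|))$, equal to $0$ when $x_n=0$, and $\mathscr K_\phi(0)=0$. A Lipschitz function $\phi:[0,+\infty)\to\mathbb C$ with $\phi(0)=0$ is expansive if for every $M$ there exists $N$ such that $|s-t|\ge N$ implies $|\phi(s)-\phi(t)|\ge M$. For $X$, or a subspace $Y$ generated by a disjoint sequence (the closed linear span of an infinite sequence of nonzero disjointly supported vectors), $M_X(n)=\sup\{\|x_1+\dots+x_n\|: x_1,\dots,x_n\text{ pairwise disjointly supported in the unit ball of }X\}$. $f\sim g$ means $0<\liminf f(n)/g(n)\le\limsup f(n)/g(n)<\infty$. A homogeneous map $\Omega$ from $X$ into the space $\mathbb C^{\mathbb N}$ of all sequences is trivial on a subspace $W$ if there exist a linear map $\ell:W\to\mathbb C^{\mathbb N}$ and a constant $C$ with $\Omega x-\ell x\in X$ and $\|\Omega x-\ell x\|\le C\|x\|$ for all $x\in W$. It is singular if it is not trivial on any infinite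 dimensional closed subspace of $X$. *)

theory Defs
  imports "HOL-Analysis.Analysis"
begin

text \<open>
  A complex Banach space is a type of class \<^class>\<open>banach\<close> together with a complex scalar
  multiplication that extends the real one and for which the norm is homogeneous.
\<close>

locale complex_banach = vector_space scl
  for scl :: "complex \<Rightarrow> 'a::banach \<Rightarrow> 'a" +
  assumes scl_of_real: "scl (complex_of_real r) x = r *\<^sub>R x"
    and norm_scl: "norm (scl c x) = cmod c * norm x"

definition schauder_basis :: "(complex \<Rightarrow> 'a::banach \<Rightarrow> 'a) \<Rightarrow> (nat \<Rightarrow> 'a) \<Rightarrow> bool" where
  "schauder_basis scl e \<longleftrightarrow> (\<forall>x. \<exists>!a. (\<lambda>n. scl (a n) (e n)) sums x)"

text \<open>
  The multipliers range over all unimodular complex numbers, not just over signs: this is what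
  makes \<open>X\<close> a complex Banach lattice for the coordinatewise modulus, with the given norm.
\<close>

definition one_unconditional :: "(complex \<Rightarrow> 'a::banach \<Rightarrow> 'a) \<Rightarrow> (nat \<Rightarrow> 'a) \<Rightarrow> bool" where
  "one_unconditional scl e \<longleftrightarrow>
     (\<forall>N a \<theta>. (\<forall>n. cmod (\<theta> n) = 1) \<longrightarrow>
        norm (\<Sum>n<N. scl (\<theta> n * a n) (e n)) \<le> norm (\<Sum>n<N. scl (a n) (e n)))"

definition normalized_unconditional_basis ::
    "(complex \<Rightarrow> 'a::banach \<Rightarrow> 'a) \<Rightarrow> (nat \<Rightarrow> 'a) \<Rightarrow> bool" where
  "normalized_unconditional_basis scl e \<longleftrightarrow>
     schauder_basis scl e \<and> one_unconditional scl e \<and> (\<forall>n. norm (e n) = 1)"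

text \<open>
  The map \<open>coord scl e\<close> is the embedding of \<open>X\<close> into the space of all complex sequences;
  a sequence \<open>a\<close> belongs to \<open>X\<close> iff \<open>a = coord scl e y\<close> for some \<open>y\<close>.
\<close>

definition coord :: "(complex \<Rightarrow> 'a::banach \<Rightarrow> 'a) \<Rightarrow> (nat \<Rightarrow> 'a) \<Rightarrow> 'a \<Rightarrow> nat \<Rightarrow> complex" where
  "coord scl e x = (THE a. (\<lambda>n. scl (a n) (e n)) sums x)"

definition supp :: "(complex \<Rightarrow> 'a::banach \<Rightarrow> 'a) \<Rightarrow> (nat \<Rightarrow> 'a) \<Rightarrow> 'a \<Rightarrow> nat set" where
  "supp scl e x = {n. coord scl e x n \<noteq> 0}"

text \<open>
  Supports in \<open>W\<close> are taken with respect to the basis of \<open>X\<close>. If \<open>W\<close> is generated by a disjoint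
  sequence, this gives the same disjointness relation as the basis of \<open>W\<close> formed by that sequence.
  The set below is bounded by \<open>n\<close> and contains \<open>0\<close> (if \<open>0 \<in> W\<close>), so the real supremum is genuine.
\<close>

definition M_fun ::
    "(complex \<Rightarrow> 'a::banach \<Rightarrow> 'a) \<Rightarrow> (nat \<Rightarrow> 'a) \<Rightarrow> 'a set \<Rightarrow> nat \<Rightarrow> real" where
  "M_fun scl e W n =
     Sup {norm (\<Sum>i<n. x i) | x. (\<forall>i<n. x i \<in> W \<and> norm (x i) \<le> 1) \<and>
                                disjoint_family_on (\<lambda>i. supp scl e (x i)) {..<n}}"

definition asymp_equiv_const :: "(nat \<Rightarrow> real) \<Rightarrow> (nat \<Rightarrow> real) \<Rightarrow> bool" where
  "asymp_equiv_const f g \<longleftrightarrow>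
     0 < liminf (\<lambda>n. ereal (f n / g n)) \<and> limsup (\<lambda>n. ereal (f n / g n)) < \<infinity>"

definition disjoint_sequence ::
    "(complex \<Rightarrow> 'a::banach \<Rightarrow> 'a) \<Rightarrow> (nat \<Rightarrow> 'a) \<Rightarrow> (nat \<Rightarrow> 'a) \<Rightarrow> bool" where
  "disjoint_sequence scl e u \<longleftrightarrow>
     (\<forall>k. u k \<noteq> 0) \<and> disjoint_family (\<lambda>k. supp scl e (u k))"

definition self_similar :: "(complex \<Rightarrow> 'a::banach \<Rightarrow> 'a) \<Rightarrow> (nat \<Rightarrow> 'a) \<Rightarrow> bool" where
  "self_similar scl e \<longleftrightarrow>
     (\<forall>u. disjoint_sequence scl e u \<longrightarrow>
        asymp_equiv_const (M_fun scl e UNIV)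
                          (M_fun scl e (closure (module.span scl (range u)))))"

text \<open>Only the values of \<open>\<phi>\<close> on \<open>[0,\<infinity>)\<close> are constrained, and only those are used below.\<close>

definition expansive :: "(real \<Rightarrow> complex) \<Rightarrow> bool" where
  "expansive \<phi> \<longleftrightarrow>
     (\<exists>L. L-lipschitz_on {0..} \<phi>) \<and> \<phi> 0 = 0 \<and>
     (\<forall>M::real. \<exists>N::real. \<forall>s\<ge>0. \<forall>t\<ge>0. \<bar>s - t\<bar> \<ge> N \<longrightarrow> cmod (\<phi> s - \<phi> t) \<ge> M)"

text \<open>
  Since \<open>\<bar>x\<^sub>n\<bar> \<le> \<parallel>x\<parallel>\<close> for a normalized 1-unconditional basis, the argument of \<open>\<phi>\<close> is nonnegative
  whenever \<open>x\<^sub>n \<noteq> 0\<close>.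
\<close>

definition kalton_peck ::
    "(complex \<Rightarrow> 'a::banach \<Rightarrow> 'a) \<Rightarrow> (nat \<Rightarrow> 'a) \<Rightarrow> (real \<Rightarrow> complex) \<Rightarrow> 'a \<Rightarrow> nat \<Rightarrow> complex" where
  "kalton_peck scl e \<phi> x n =
     (if coord scl e x n = 0 then 0
      else coord scl e x n * \<phi> (- ln (cmod (coord scl e x n) / norm x)))"

definition linear_into_sequences ::
    "(complex \<Rightarrow> 'a::banach \<Rightarrow> 'a) \<Rightarrow> 'a set \<Rightarrow> ('a \<Rightarrow> nat \<Rightarrow> complex) \<Rightarrow> bool" where
  "linear_into_sequences scl W l \<longleftrightarrow>
     (\<forall>x\<in>W. \<forall>y\<in>W. \<forall>n. l (x + y) n = l x n + l y n) \<and>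
     (\<forall>c. \<forall>x\<in>W. \<forall>n. l (scl c x) n = c * l x n)"

definition trivial_on ::
    "(complex \<Rightarrow> 'a::banach \<Rightarrow> 'a) \<Rightarrow> (nat \<Rightarrow> 'a) \<Rightarrow> ('a \<Rightarrow> nat \<Rightarrow> complex) \<Rightarrow> 'a set \<Rightarrow> bool" where
  "trivial_on scl e \<Omega> W \<longleftrightarrow>
     (\<exists>l C. linear_into_sequences scl W l \<and>
        (\<forall>x\<in>W. \<exists>y. (\<forall>n. coord scl e y n = \<Omega> x n - l x n) \<and> norm y \<le> C * norm x))"

definition singular ::
    "(complex \<Rightarrow> 'a::banach \<Rightarrow> 'a) \<Rightarrow> (nat \<Rightarrow> 'a) \<Rightarrow> ('a \<Rightarrow> nat \<Rightarrow> complex) \<Rightarrow> bool" where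
  "singular scl e \<Omega> \<longleftrightarrow>
     (\<forall>W. module.subspace scl W \<and> closed W \<and> \<not> (\<exists>B. finite B \<and> W = module.span scl B) \<longrightarrow>
        \<not> trivial_on scl e \<Omega> W)"

end

theory Submission
  imports Defs
begin

text \<open>
  Suppose that the map differs from a linear map by a bounded one on an infinite dimensional
  subspace \<open>W\<close>. A gliding hump yields unit vectors of \<open>W\<close> very close to disjoint blocks \<open>u\<^sub>k\<close>, and
  quasi-linearity transfers triviality to the finite combinations of the \<open>u\<^sub>k\<close>. Averaging over roots
  of unity replaces the linear map by multiplication by a fixed sequence \<open>g\<close>, so the map minus
  multiplication by \<open>g\<close> preserves disjointness. If \<open>x\<^sub>1, \<dots>, x\<^sub>n\<close> are disjoint in the unit ball of
  the span of the \<open>u\<^sub>k\<close> and \<open>M\<close> is the norm of their sum \<open>s\<close>, then comparing the value at \<open>s\<close> with the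
  sum of the values at the \<open>x\<^sub>i\<close> shifts the argument of \<open>\<phi>\<close> by \<open>ln M\<close>, while the difference has norm
  at most a constant times \<open>M + M\<^sub>X(n)\<close>. By self-similarity \<open>M\<close> can be taken comparable to \<open>M\<^sub>X(n)\<close>,
  hence arbitrarily large, contradicting expansiveness.
\<close>

section \<open>Coordinates, domination and the lattice norm\<close>

locale unconditional_basis = complex_banach scl
  for scl :: "complex \<Rightarrow> 'a::banach \<Rightarrow> 'a" +
  fixes e :: "nat \<Rightarrow> 'a"
  assumes basis: "normalized_unconditional_basis scl e"
begin

abbreviation co :: "'a \<Rightarrow> nat \<Rightarrow> complex" where "co \<equiv> coord scl e"

lemma norm_e [simp]: "norm (e n) = 1"
  using basis by (simp add: normalized_unconditional_basis_def)

lemma bounded_linear_scl: "bounded_linear (scl c)"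
proof (rule bounded_linear_intro[where K = "cmod c"])
  show "scl c (r *\<^sub>R x) = r *\<^sub>R scl c x" for r x
    by (simp only: scl_of_real[symmetric] scale_left_commute)
qed (auto simp: scale_right_distrib norm_scl mult.commute)

lemma coord_sums: "(\<lambda>n. scl (co x n) (e n)) sums x"
proof -
  have "\<exists>!a. (\<lambda>n. scl (a n) (e n)) sums x"
    using basis by (simp add: normalized_unconditional_basis_def schauder_basis_def)
  then show ?thesis unfolding coord_def by (rule theI')
qed

lemma coord_unique: "(\<lambda>n. scl (a n) (e n)) sums x \<Longrightarrow> co x = a"
  using basis coord_sums[of x]
  by (metis normalized_unconditional_basis_def schauder_basis_def)

lemma coord_add: "co (x + y) n = co x n + co y n"
proof -
  have "(\<lambda>n. scl (co x n + co y n) (e n)) sums (x + y)"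
    using sums_add[OF coord_sums[of x] coord_sums[of y]] by (simp add: scale_left_distrib)
  then show ?thesis by (simp add: coord_unique)
qed

lemma coord_scl: "co (scl c x) n = c * co x n"
proof -
  have "(\<lambda>n. scl (c * co x n) (e n)) sums (scl c x)"
    using bounded_linear.sums[OF bounded_linear_scl coord_sums[of x], of c] by simp
  then show ?thesis by (simp add: coord_unique)
qed

lemma coord_zero [simp]: "co 0 n = 0"
  using coord_scl[of 0 0 n] by simp

lemma coord_diff: "co (x - y) n = co x n - co y n"
  using coord_add[of "x - y" y n] by simp

lemma coord_sum: "co (sum f A) n = (\<Sum>i\<in>A. co (f i) n)"
  by (induction A rule: infinite_finite_induct) (auto simp: coord_add)

lemma coord_inject: "(\<And>n. co x n = co y n) \<Longrightarrow> x = y"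
  using coord_sums[of x] coord_sums[of y] sums_unique2 by (metis (no_types, lifting) ext)

lemma coord_finite_sum:
  "co (\<Sum>n<N. scl (a n) (e n)) m = (if m < N then a m else 0)"
proof -
  have "(\<lambda>n. scl (if n < N then a n else 0) (e n)) sums
      (\<Sum>n<N. scl (if n < N then a n else 0) (e n))"
    by (rule sums_finite) auto
  moreover have "(\<Sum>n<N. scl (if n < N then a n else 0) (e n)) = (\<Sum>n<N. scl (a n) (e n))"
    by (rule sum.cong) auto
  ultimately have "(\<lambda>n. scl (if n < N then a n else 0) (e n)) sums (\<Sum>n<N. scl (a n) (e n))"
    by (simp only:)
  from coord_unique[OF this] show ?thesis by simp
qed

text \<open>The chord through \<open>c\<close> perpendicular to the radius has its endpoints at
  angle \<open>arccos (cmod c)\<close> on either side of \<open>c\<close>.\<close>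

lemma midpoint_unimodular:
  assumes "cmod c \<le> 1"
  obtains s t where "cmod s = 1" "cmod t = 1" "c = (s + t) / 2"
proof
  let ?r = "arccos (cmod c)"
  show "cmod (cis (Arg c + ?r)) = 1" "cmod (cis (Arg c - ?r)) = 1" by simp_all
  have "cis (Arg c + ?r) + cis (Arg c - ?r) = cis (Arg c) * (cis ?r + cis (- ?r))"
    by (simp add: cis_mult distrib_left)
  also have "cis ?r + cis (- ?r) = complex_of_real (2 * cmod c)"
    using assms by (simp add: complex_eq_iff cos_arccos order_trans[OF _ norm_ge_zero])
  finally show "c = (cis (Arg c + ?r) + cis (Arg c - ?r)) / 2"
    using rcis_cmod_Arg[of c] by (simp add: rcis_def mult.commute)
qed

text \<open>\<open>b\<close> is the mean of two unimodular multiples of \<open>a\<close>, and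
  1-unconditionality controls each of these.\<close>

lemma norm_finite_sum_mono:
  assumes "\<And>n. cmod (b n) \<le> cmod (a n)"
  shows "norm (\<Sum>n<N. scl (b n) (e n)) \<le> norm (\<Sum>n<N. scl (a n) (e n))"
proof -
  have unc: "norm (\<Sum>n<N. scl (\<theta> n * a n) (e n)) \<le> norm (\<Sum>n<N. scl (a n) (e n))"
    if "\<And>n. cmod (\<theta> n) = 1" for \<theta>
    using basis that unfolding normalized_unconditional_basis_def one_unconditional_def by blast
  have "\<exists>s t. cmod s = 1 \<and> cmod t = 1 \<and> b n = (s + t) / 2 * a n" for n
  proof (cases "a n = 0")
    case True
    then show ?thesis using assms[of n] by (intro exI[of _ 1]) auto
  next
    case False
    then have "cmod (b n / a n) \<le> 1" using assms[of n] by (simp add: norm_divide)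
    then show ?thesis using False midpoint_unimodular by (metis nonzero_eq_divide_eq)
  qed
  then obtain s t where st: "\<And>n. cmod (s n) = 1" "\<And>n. cmod (t n) = 1"
    and b: "\<And>n. b n = (s n + t n) / 2 * a n" by metis
  have "scl (b n) (e n) = scl (1/2) (scl (s n * a n) (e n) + scl (t n * a n) (e n))" for n
  proof -
    have "b n = 1/2 * (s n * a n) + 1/2 * (t n * a n)" by (simp add: b field_simps)
    then show ?thesis by (simp only: scale_right_distrib scale_scale scale_left_distrib)
  qed
  then have "(\<Sum>n<N. scl (b n) (e n)) =
      scl (1/2) ((\<Sum>n<N. scl (s n * a n) (e n)) + (\<Sum>n<N. scl (t n * a n) (e n)))"
    by (simp only: scale_sum_right[symmetric] sum.distrib)
  then have "norm (\<Sum>n<N. scl (b n) (e n)) \<le>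
      1/2 * (norm (\<Sum>n<N. scl (s n * a n) (e n)) + norm (\<Sum>n<N. scl (t n * a n) (e n)))"
    by (simp add: norm_scl norm_triangle_ineq)
  with unc[of s, OF st(1)] unc[of t, OF st(2)] show ?thesis by simp
qed

text \<open>Increments of the partial sums for \<open>z\<close> are dominated by those for
  \<open>y\<close>, so the series converges: the space is an order ideal among all scalar
  sequences.\<close>

lemma dominated_exists:
  assumes "\<And>n. cmod (z n) \<le> cmod (co y n)"
  obtains x where "co x = z" "norm x \<le> norm y"
proof -
  let ?S = "\<lambda>N. \<Sum>n<N. scl (z n) (e n)" and ?T = "\<lambda>N. \<Sum>n<N. scl (co y n) (e n)"
  have T: "?T \<longlonglongrightarrow> y" using coord_sums[of y] by (simp add: sums_def)
  have diff: "norm (?S N - ?S M) \<le> norm (?T N - ?T M)" if "M \<le> N" for M N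
  proof -
    have tail: "(\<Sum>n<N. scl (f n) (e n)) - (\<Sum>n<M. scl (f n) (e n)) =
        (\<Sum>n<N. scl (if n < M then 0 else f n) (e n))" for f
    proof -
      have "(\<Sum>n<N. scl (if n < M then 0 else f n) (e n)) =
          (\<Sum>n\<in>{..<N} - {..<M}. scl (f n) (e n))"
        by (intro sum.mono_neutral_cong_right) auto
      then show ?thesis using that sum_diff[of "{..<N}" "{..<M}" "\<lambda>n. scl (f n) (e n)"] by simp
    qed
    show ?thesis unfolding tail using assms by (intro norm_finite_sum_mono) auto
  qed
  have "Cauchy ?S"
  proof (rule CauchyI)
    fix \<epsilon> :: real assume "0 < \<epsilon>"
    then obtain K where K: "\<forall>M\<ge>K. \<forall>N\<ge>K. norm (?T M - ?T N) < \<epsilon>"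
      using LIMSEQ_imp_Cauchy[OF T] CauchyD by blast
    have "norm (?S M - ?S N) < \<epsilon>" if "M \<ge> K" "N \<ge> K" for M N
    proof (cases "N \<le> M")
      case True
      have "norm (?T M - ?T N) < \<epsilon>" using K that by blast
      with diff[OF True] show ?thesis by linarith
    next
      case False
      have "norm (?T N - ?T M) < \<epsilon>" using K that by blast
      with diff[of M N] False have "norm (?S N - ?S M) < \<epsilon>" by simp
      then show ?thesis by (simp add: norm_minus_commute)
    qed
    then show "\<exists>K. \<forall>M\<ge>K. \<forall>N\<ge>K. norm (?S M - ?S N) < \<epsilon>" by blast
  qed
  then obtain x where x: "?S \<longlonglongrightarrow> x" by (auto simp: Cauchy_convergent_iff convergent_def)
  show ?thesis
  proof
    show "co x = z" using x by (intro coord_unique) (simp add: sums_def)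
    have "norm (?S N) \<le> norm (?T N)" for N using assms by (rule norm_finite_sum_mono)
    then show "norm x \<le> norm y"
      using LIMSEQ_le[OF tendsto_norm[OF x] tendsto_norm[OF T]] by blast
  qed
qed

lemma norm_mono:
  assumes "\<And>n. cmod (co x n) \<le> cmod (co y n)"
  shows "norm x \<le> norm y"
  using dominated_exists[of "co x" y] assms coord_inject by metis

lemma cmod_coord_le: "cmod (co x m) \<le> norm x"
proof -
  let ?v = "\<Sum>n<Suc m. scl (if n = m then co x m else 0) (e n)"
  have "?v = scl (co x m) (e m)" by simp
  moreover have "norm ?v \<le> norm x"
    by (rule norm_mono) (simp only: coord_finite_sum, simp)
  ultimately show ?thesis by (simp add: norm_scl)
qed

lemma continuous_on_coord: "continuous_on A (\<lambda>x. co x m)"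
proof -
  have "bounded_linear (\<lambda>x. co x m)"
  proof (rule bounded_linear_intro[where K = 1])
    show "co (r *\<^sub>R x) m = r *\<^sub>R co x m" for r x
      by (simp only: scl_of_real[symmetric] coord_scl scaleR_conv_of_real)
  qed (auto simp: coord_add cmod_coord_le)
  then show ?thesis by (rule linear_continuous_on)
qed

section \<open>Truncations and norm bounds for scalar sequences\<close>

definition trunc :: "nat \<Rightarrow> 'a \<Rightarrow> 'a" where
  "trunc N x = (\<Sum>n<N. scl (co x n) (e n))"

lemma coord_trunc: "co (trunc N x) m = (if m < N then co x m else 0)"
  unfolding trunc_def by (rule coord_finite_sum)

lemma trunc_tendsto: "(\<lambda>N. trunc N x) \<longlonglongrightarrow> x"
  unfolding trunc_def using coord_sums[of x] by (simp only: sums_def)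

lemma norm_trunc_le: "norm (trunc N x) \<le> norm x"
  by (rule norm_mono) (simp add: coord_trunc)

text \<open>Values of the Kalton-Peck map may lie outside \<open>X\<close>; this predicate carries
  membership in \<open>X\<close> and a norm bound together through pointwise calculations.\<close>

definition in_ball :: "real \<Rightarrow> (nat \<Rightarrow> complex) \<Rightarrow> bool" where
  "in_ball B z \<longleftrightarrow> (\<exists>y. co y = z \<and> norm y \<le> B)"

lemma in_ball_coord: "norm x \<le> B \<Longrightarrow> in_ball B (co x)"
  unfolding in_ball_def by blast

lemma in_ball_add:
  assumes "in_ball A x" "in_ball B y"
  shows "in_ball (A + B) (\<lambda>n. x n + y n)"
proof -
  obtain u v where "co u = x" "norm u \<le> A" "co v = y" "norm v \<le> B"
    using assms by (auto simp: in_ball_def)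
  then show ?thesis
    by (auto simp: in_ball_def coord_add intro!: exI[of _ "u + v"] norm_triangle_le)
qed

lemma in_ball_scale:
  assumes "in_ball A x" "cmod c * A \<le> B"
  shows "in_ball B (\<lambda>n. c * x n)"
proof -
  obtain u where "co u = x" "norm u \<le> A"
    using assms by (auto simp: in_ball_def)
  moreover then have "cmod c * norm u \<le> cmod c * A" by (simp add: mult_left_mono)
  ultimately show ?thesis using assms(2)
    by (auto simp: in_ball_def coord_scl norm_scl intro!: exI[of _ "scl c u"])
qed

lemma in_ball_diff:
  assumes "in_ball A x" "in_ball B y"
  shows "in_ball (A + B) (\<lambda>n. x n - y n)"
  using in_ball_add[OF assms(1) in_ball_scale[OF assms(2), of "-1" B]] by simp

lemma in_ball_sum:
  assumes "\<And>i. i \<in> I \<Longrightarrow> in_ball (A i) (x i)" "finite I"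
  shows "in_ball (\<Sum>i\<in>I. A i) (\<lambda>n. \<Sum>i\<in>I. x i n)"
  using assms(2,1)
proof (induction I rule: finite_induct)
  case empty
  then show ?case by (auto simp: in_ball_def intro!: exI[of _ 0])
next
  case (insert i I)
  then show ?case using in_ball_add by simp
qed

lemma in_ball_mono:
  assumes "in_ball A y" "\<And>n. cmod (z n) \<le> cmod (y n)" "A \<le> B"
  shows "in_ball B z"
proof -
  obtain u where "co u = y" "norm u \<le> A" using assms(1) by (auto simp: in_ball_def)
  with assms(2) dominated_exists[of z u] obtain x where "co x = z" "norm x \<le> norm u" by metis
  with \<open>norm u \<le> A\<close> assms(3) show ?thesis by (auto simp: in_ball_def)
qed

text \<open>Moduli of coordinates again lie in \<open>X\<close> with no larger norm, so pointwise
  inequalities between moduli become norm estimates. The error estimates for \<open>kp\<close> enter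
  in this way.\<close>

lemma in_ball_le_sum:
  assumes "\<And>n. cmod (z n) \<le> (\<Sum>i\<in>I. c i * cmod (co (x i) n))"
    and "\<And>i. i \<in> I \<Longrightarrow> c i \<ge> 0" "finite I"
  shows "in_ball (\<Sum>i\<in>I. c i * norm (x i)) z"
proof (rule in_ball_mono[OF _ _ order_refl])
  have "in_ball (norm (x i)) (\<lambda>n. complex_of_real (cmod (co (x i) n)))" for i
    by (rule in_ball_mono[OF in_ball_coord[OF order_refl]]) auto
  then show "in_ball (\<Sum>i\<in>I. c i * norm (x i))
      (\<lambda>n. \<Sum>i\<in>I. of_real (c i) * of_real (cmod (co (x i) n)))"
    using assms(2,3) by (intro in_ball_sum in_ball_scale) auto
  fix n
  have "(\<Sum>i\<in>I. c i * cmod (co (x i) n)) \<le>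
      cmod (of_real (\<Sum>i\<in>I. c i * cmod (co (x i) n)))" by (simp only: norm_of_real abs_ge_self)
  with assms(1)[of n] show "cmod (z n) \<le>
      cmod (\<Sum>i\<in>I. of_real (c i) * of_real (cmod (co (x i) n)))"
    by simp
qed

lemma in_ball_le_add:
  assumes "\<And>n. cmod (z n) \<le> c * (cmod (co x n) + cmod (co y n))" "c \<ge> 0"
  shows "in_ball (c * (norm x + norm y)) z"
  using in_ball_le_sum[of z "\<lambda>_. c" "\<lambda>i. if i then x else y" "UNIV :: bool set"] assms
  by (simp add: UNIV_bool distrib_left add.commute)

end

section \<open>The scalar function behind the Kalton-Peck map\<close>

text \<open>
  The pointwise version of the Kalton--Peck map, without the normalisation by the norm and with
  \<open>\<phi>\<close> extended to negative arguments by \<open>\<phi> 0\<close>, so that it is defined on all scalars.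
\<close>

definition kp :: "(real \<Rightarrow> complex) \<Rightarrow> complex \<Rightarrow> complex" where
  "kp \<phi> t = t * \<phi> (max 0 (- ln (cmod t)))"

lemma kp_zero [simp]: "kp \<phi> 0 = 0"
  by (simp add: kp_def)

lemma kp_unimodular: "cmod c = 1 \<Longrightarrow> kp \<phi> (c * t) = c * kp \<phi> t"
  by (simp add: kp_def norm_mult)

text \<open>Cutting off at \<open>0\<close> is nonexpansive, so the Lipschitz bound extends from the
  half-line to all real arguments.\<close>

lemma lipschitz_max:
  assumes "L-lipschitz_on {0..} \<phi>"
  shows "cmod (\<phi> (max 0 s) - \<phi> (max 0 t)) \<le> L * \<bar>s - t\<bar>"
proof -
  have "cmod (\<phi> (max 0 s) - \<phi> (max 0 t)) \<le> L * \<bar>max 0 s - max 0 t\<bar>"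
    using lipschitz_onD[OF assms, of "max 0 s" "max 0 t"] by (simp add: dist_norm)
  also have "\<dots> \<le> L * \<bar>s - t\<bar>"
    using lipschitz_on_nonneg[OF assms] by (intro mult_left_mono) (auto simp: max_def)
  finally show ?thesis .
qed

text \<open>
  Up to an error \<open>L * A\<close>, \<open>kp\<close> is linear on the disc of radius \<open>A\<close>; this makes it quasi-additive.
\<close>

lemma kp_near:
  assumes "L-lipschitz_on {0..} \<phi>" "cmod t \<le> A"
  shows "cmod (kp \<phi> t - t * \<phi> (max 0 (- ln A))) \<le> L * A"
proof (cases "t = 0")
  case True
  then show ?thesis using assms lipschitz_on_nonneg[OF assms(1)] by simp
next
  case False
  then have pos: "0 < cmod t" "0 < A" using assms(2) less_le_trans[of 0 "cmod t" A] by auto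
  have "cmod (kp \<phi> t - t * \<phi> (max 0 (- ln A))) =
      cmod t * cmod (\<phi> (max 0 (- ln (cmod t))) - \<phi> (max 0 (- ln A)))"
    by (simp add: kp_def norm_mult[symmetric] right_diff_distrib)
  also have "\<dots> \<le> cmod t * (L * \<bar>ln A - ln (cmod t)\<bar>)"
    using lipschitz_max[OF assms(1), of "- ln (cmod t)" "- ln A"] by (intro mult_left_mono) auto
  also have "\<bar>ln A - ln (cmod t)\<bar> = ln (A / cmod t)"
    using pos assms(2) ln_div[of A "cmod t"] by (simp add: ln_mono)
  \<comment> \<open>The inequality \<open>ln u \<le> u\<close> at \<open>u = A / cmod t\<close>
    cancels the factor \<open>cmod t\<close>.\<close>
  also have "cmod t * (L * ln (A / cmod t)) \<le> cmod t * (L * (A / cmod t))"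
    using ln_bound[of "A / cmod t"] pos assms(2) lipschitz_on_nonneg[OF assms(1)]
    by (intro mult_left_mono) auto
  finally show ?thesis using pos by simp
qed

text \<open>All three values of \<open>kp\<close> are close to multiplication by one common
  constant; these products cancel by additivity, and three errors remain.\<close>

lemma kp_add:
  assumes "L-lipschitz_on {0..} \<phi>"
  shows "cmod (kp \<phi> (s + t) - kp \<phi> s - kp \<phi> t) \<le> 3 * L * (cmod s + cmod t)"
proof -
  define A where "A = cmod s + cmod t"
  define c where "c = \<phi> (max 0 (- ln A))"
  have "cmod (s + t) \<le> A" "cmod s \<le> A" "cmod t \<le> A"
    by (auto simp: A_def norm_triangle_ineq)
  note near = this[THEN kp_near[OF assms], folded c_def]
  have "kp \<phi> (s + t) - kp \<phi> s - kp \<phi> t =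
      (kp \<phi> (s + t) - (s + t) * c) - (kp \<phi> s - s * c) - (kp \<phi> t - t * c)"
    by (simp add: algebra_simps)
  also have "cmod \<dots> \<le> cmod (kp \<phi> (s + t) - (s + t) * c) + cmod (kp \<phi> s - s * c) + cmod (kp \<phi> t - t * c)"
    by (meson add_right_mono norm_triangle_ineq4 order_trans)
  finally show ?thesis using near by (simp add: A_def algebra_simps)
qed

text \<open>
  The weights \<open>Suc i\<close> are harmless below, since the \<open>t i\<close> will be coordinates of a rapidly decreasing
  sequence of perturbations.
\<close>

lemma kp_sum:
  assumes "L-lipschitz_on {0..} \<phi>"
  shows "cmod (kp \<phi> (\<Sum>i<n. t i) - (\<Sum>i<n. kp \<phi> (t i))) \<le> (\<Sum>i<n. 3 * L * real (Suc i) * cmod (t i))"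
proof (induction n arbitrary: t)
  case 0
  then show ?case by simp
next
  case (Suc n)
  have L: "L \<ge> 0" using assms by (rule lipschitz_on_nonneg)
  \<comment> \<open>Splitting off the first term each time makes \<open>t i\<close> take part in
    \<open>Suc i\<close> splittings, whence its weight.\<close>
  let ?S = "\<Sum>i<n. t (Suc i)"
  have "kp \<phi> (\<Sum>i<Suc n. t i) - (\<Sum>i<Suc n. kp \<phi> (t i)) =
      (kp \<phi> (t 0 + ?S) - kp \<phi> (t 0) - kp \<phi> ?S) + (kp \<phi> ?S - (\<Sum>i<n. kp \<phi> (t (Suc i))))"
    by (simp add: sum.lessThan_Suc_shift del: sum.lessThan_Suc)
  also have "cmod \<dots> \<le> 3 * L * (cmod (t 0) + cmod ?S) + (\<Sum>i<n. 3 * L * real (Suc i) * cmod (t (Suc i)))"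
    using kp_add[OF assms] Suc.IH by (intro norm_triangle_mono)
  also have "cmod ?S \<le> (\<Sum>i<n. cmod (t (Suc i)))" by (rule norm_sum)
  also have "3 * L * (cmod (t 0) + (\<Sum>i<n. cmod (t (Suc i)))) + (\<Sum>i<n. 3 * L * real (Suc i) * cmod (t (Suc i))) =
      (\<Sum>i<Suc n. 3 * L * real (Suc i) * cmod (t i))"
    by (simp add: sum.lessThan_Suc_shift sum_distrib_left sum.distrib[symmetric] algebra_simps
        del: sum.lessThan_Suc)
  finally show ?case using L by (simp add: mult_left_mono)
qed

text \<open>Multiplying by \<open>a\<close> shifts the logarithm by \<open>ln (cmod a)\<close>, and
  the Lipschitz condition bounds the effect.\<close>

lemma kp_mult:
  assumes "L-lipschitz_on {0..} \<phi>"
  shows "cmod (kp \<phi> (a * t) - a * kp \<phi> t) \<le> L * (cmod a * \<bar>ln (cmod a)\<bar>) * cmod t"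
proof (cases "a = 0 \<or> t = 0")
  case True
  then show ?thesis by auto
next
  case False
  then have "cmod (kp \<phi> (a * t) - a * kp \<phi> t) = cmod a * cmod t *
      cmod (\<phi> (max 0 (- ln (cmod (a * t)))) - \<phi> (max 0 (- ln (cmod t))))"
    by (simp add: kp_def norm_mult[symmetric] right_diff_distrib mult.assoc)
  also have "\<dots> \<le> cmod a * cmod t * (L * \<bar>ln (cmod a)\<bar>)"
    using lipschitz_max[OF assms, of "- ln (cmod (a * t))" "- ln (cmod t)"] False
    by (intro mult_left_mono) (auto simp: norm_mult ln_mult)
  finally show ?thesis by (simp add: mult_ac)
qed

text \<open>For small \<open>t\<close> this is \<open>ln u \<le> u\<close> at
  \<open>u = 1 / t\<close>. The range up to \<open>2\<close> covers both the norms and the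
  coefficients met below.\<close>

lemma mult_abs_ln_le:
  fixes t :: real
  assumes "0 \<le> t" "t \<le> 2"
  shows "t * \<bar>ln t\<bar> \<le> 2"
proof (cases "t \<le> 1")
  case True
  show ?thesis
  proof (cases "t = 0")
    case False
    then have "t * \<bar>ln t\<bar> = t * ln (1 / t)" using True assms by (simp add: ln_div)
    also have "\<dots> \<le> t * (1 / t)" using False assms by (intro mult_left_mono ln_bound) auto
    finally show ?thesis using False by simp
  qed simp
next
  case False
  then have "\<bar>ln t\<bar> \<le> 1" using ln_le_minus_one[of t] assms by simp
  then have "t * \<bar>ln t\<bar> \<le> 2 * 1" using assms by (intro mult_mono) auto
  then show ?thesis by simp
qed

section \<open>Removing the normalisation; the gliding hump\<close>

context unconditional_basis
begin

text \<open>Dropping the division by \<open>norm x\<close> shifts the argument of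
  \<open>\<phi>\<close> by \<open>ln (norm x)\<close>. The defect stays bounded because
  \<open>t * \<bar>ln t\<bar>\<close> does near \<open>0\<close>.\<close>

lemma kalton_peck_kp:
  assumes "L-lipschitz_on {0..} \<phi>" "norm x \<le> 2"
  shows "in_ball (2 * L) (\<lambda>m. kp \<phi> (co x m) - kalton_peck scl e \<phi> x m)"
proof -
  let ?c = "L * \<bar>ln (norm x)\<bar>"
  have L: "L \<ge> 0" using assms(1) by (rule lipschitz_on_nonneg)
  have "cmod (kp \<phi> (co x m) - kalton_peck scl e \<phi> x m) \<le> ?c * cmod (co x m)" for m
  proof (cases "co x m = 0")
    case True
    then show ?thesis by (simp add: kalton_peck_def)
  next
    case False
    then have pos: "0 < cmod (co x m)" "cmod (co x m) \<le> norm x" "0 < norm x"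
      using cmod_coord_le[of x m] by auto
    let ?s = "- ln (cmod (co x m))" and ?t = "- ln (cmod (co x m) / norm x)"
    \<comment> \<open>No coordinate exceeds the norm, so the cut-off in \<open>kp\<close> is
      inactive at the normalised argument.\<close>
    have "0 \<le> ?t" using pos by simp
    then have "kp \<phi> (co x m) - kalton_peck scl e \<phi> x m =
        co x m * (\<phi> (max 0 ?s) - \<phi> (max 0 ?t))"
      using False by (simp add: kp_def kalton_peck_def right_diff_distrib max_def)
    also have "cmod \<dots> \<le> cmod (co x m) * (L * \<bar>?s - ?t\<bar>)"
      unfolding norm_mult by (intro mult_left_mono lipschitz_max[OF assms(1)]) simp
    also have "\<bar>?s - ?t\<bar> = \<bar>ln (norm x)\<bar>" using pos by (simp add: ln_div)
    finally show ?thesis by (simp add: mult_ac)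
  qed
  then have "in_ball (?c * norm x) (\<lambda>m. kp \<phi> (co x m) - kalton_peck scl e \<phi> x m)"
    using in_ball_le_sum[of _ "\<lambda>_. ?c" "\<lambda>_. x" "{()}"] L by simp
  moreover have "?c * norm x \<le> 2 * L"
    using mult_left_mono[OF mult_abs_ln_le[of "norm x"] L] assms(2) by (simp add: mult_ac)
  ultimately show ?thesis by (rule in_ball_mono[OF _ order_refl])
qed

text \<open>One linear equation lowers the dimension by at most one: a finite spanning set of the
  kernel together with one vector outside it would span \<open>V\<close>.\<close>

lemma infinite_dim_kernel:
  assumes "subspace V" "\<not> (\<exists>B. finite B \<and> V = span B)"
  shows "subspace {x\<in>V. co x n = 0}" "\<not> (\<exists>B. finite B \<and> {x\<in>V. co x n = 0} = span B)"
proof -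
  show sub: "subspace {x\<in>V. co x n = 0}"
    using assms(1) by (auto simp: subspace_def coord_add coord_scl)
  show "\<not> (\<exists>B. finite B \<and> {x\<in>V. co x n = 0} = span B)"
  proof
    assume "\<exists>B. finite B \<and> {x\<in>V. co x n = 0} = span B"
    then obtain B where B: "finite B" "{x\<in>V. co x n = 0} = span B" by blast
    have "{x\<in>V. co x n = 0} \<noteq> V" using assms(2) B by auto
    then obtain v where v: "v \<in> V" "co v n \<noteq> 0" by auto
    have "B \<subseteq> V" using B(2) span_superset[of B] by auto
    then have "span (insert v B) \<subseteq> V" using v assms(1) by (intro span_minimal) auto
    moreover have "x \<in> span (insert v B)" if "x \<in> V" for x
    proof -
      have "x - scl (co x n / co v n) v \<in> {x\<in>V. co x n = 0}"
        using that v assms(1) by (auto simp: coord_diff coord_scl intro!: subspace_diff subspace_scale)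
      then show ?thesis using B(2) by (auto simp: span_breakdown_eq)
    qed
    ultimately have "V = span (insert v B)" by blast
    with B(1) assms(2) show False by blast
  qed
qed

lemma exists_unit_vector_tail:
  assumes "subspace W" "\<not> (\<exists>B. finite B \<and> W = span B)"
  shows "\<exists>w\<in>W. norm w = 1 \<and> (\<forall>m<N. co w m = 0)"
proof -
  let ?V = "\<lambda>N. {x\<in>W. \<forall>m<N. co x m = 0}"
  have "subspace (?V N) \<and> \<not> (\<exists>B. finite B \<and> ?V N = span B)"
  proof (induction N)
    case 0
    then show ?case using assms by simp
  next
    case (Suc N)
    have "?V (Suc N) = {x\<in>?V N. co x N = 0}" by (auto simp: less_Suc_eq)
    then show ?case using infinite_dim_kernel[of "?V N" N] Suc by simp
  qed
  \<comment> \<open>The choice \<open>B = {}\<close> shows that the tail subspace is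
    nonzero.\<close>
  then have V: "subspace (?V N)" "?V N \<noteq> span {}" by blast+
  then have "0 \<in> ?V N" by (simp only: subspace_0)
  with V(2) obtain v where v: "v \<in> ?V N" "v \<noteq> 0" by auto
  then have "norm (scl (of_real (1 / norm v)) v) = 1" using v(2) by (simp add: norm_scl norm_divide)
  moreover have "scl (of_real (1 / norm v)) v \<in> ?V N"
    using V(1) v(1) by (rule subspace_scale)
  ultimately show ?thesis by blast
qed

text \<open>A tail vector is truncated far enough out, and the next one is taken beyond that point.
  The vectors themselves stay in \<open>W\<close>; their truncations are disjoint blocks.\<close>

lemma gliding_hump:
  assumes "subspace W" "\<not> (\<exists>B. finite B \<and> W = span B)" "\<And>k. 0 < \<delta> k"
  obtains p w where "p 0 = 0" "strict_mono p" "\<And>k. w k \<in> W" "\<And>k. norm (w k) = 1"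
    "\<And>k m. m < p k \<Longrightarrow> co (w k) m = 0"
    "\<And>k. norm (w k - trunc (p (Suc k)) (w k)) \<le> \<delta> k"
proof -
  obtain v where v: "\<And>N. v N \<in> W" "\<And>N. norm (v N) = 1" "\<And>N m. m < N \<Longrightarrow> co (v N) m = 0"
    using exists_unit_vector_tail[OF assms(1,2)] by metis
  have "\<exists>q>N. norm (v N - trunc q (v N)) \<le> \<delta> k" for k N
  proof -
    have "(\<lambda>q. norm (v N - trunc q (v N))) \<longlonglongrightarrow> norm (v N - v N)"
      by (intro tendsto_intros trunc_tendsto)
    then have "\<forall>\<^sub>F q in sequentially. norm (v N - trunc q (v N)) < \<delta> k"
      using assms(3)[of k] by (intro order_tendstoD) auto
    with eventually_gt_at_top[of N] have "\<forall>\<^sub>F q in sequentially. q > N \<and> norm (v N - trunc q (v N)) < \<delta> k"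
      by eventually_elim auto
    then show ?thesis by (auto simp: eventually_sequentially intro: less_imp_le)
  qed
  then have "\<forall>k N. \<exists>q. N < q \<and> norm (v N - trunc q (v N)) \<le> \<delta> k" by blast
  then obtain q where "\<forall>k N. N < q k N \<and> norm (v N - trunc (q k N) (v N)) \<le> \<delta> k"
    unfolding choice_iff by blast
  then have q: "\<And>k N. N < q k N" "\<And>k N. norm (v N - trunc (q k N) (v N)) \<le> \<delta> k"
    by blast+
  define p where "p = rec_nat 0 q"
  have p: "p 0 = 0" "\<And>k. p (Suc k) = q k (p k)" by (simp_all add: p_def)
  show ?thesis
    by (rule that[of p "\<lambda>k. v (p k)"]) (auto simp: p strict_mono_Suc_iff v q)
qed

end

section \<open>Two auxiliary sums\<close>

lemma roots_of_unity_orthogonal: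
  assumes "j < K" "k < (K::nat)"
  defines "\<zeta> \<equiv> cis (2 * pi / K)"
  shows "(\<Sum>r<K. cnj (\<zeta> ^ (r * j)) * \<zeta> ^ (r * k)) = (if j = k then of_nat K else 0)"
proof -
  \<comment> \<open>The sum is geometric with ratio \<open>q\<close>, a \<open>K\<close>-th root of
    unity; distinctness of the powers of \<open>\<zeta>\<close> below \<open>K\<close> gives
    \<open>q \<noteq> 1\<close> off the diagonal.\<close>
  define q where "q = cnj (\<zeta> ^ j) * \<zeta> ^ k"
  have root: "\<zeta> ^ i = cis (2 * pi * real i / real K)" for i
    unfolding \<zeta>_def by (simp add: Complex.DeMoivre field_simps)
  have unit: "cnj (\<zeta> ^ i) * \<zeta> ^ i = 1" for i
    by (simp add: root cis_cnj cis_mult)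
  have K: "\<zeta> ^ K = 1" using assms(1) by (simp add: root)
  have "q ^ K = cnj ((\<zeta> ^ K) ^ j) * (\<zeta> ^ K) ^ k"
    by (simp only: q_def power_mult_distrib complex_cnj_power[symmetric] power_mult[symmetric] mult.commute)
  then have qK: "q ^ K = 1" by (simp add: K)
  have sum: "(\<Sum>r<K. cnj (\<zeta> ^ (r * j)) * \<zeta> ^ (r * k)) = (\<Sum>r<K. q ^ r)"
    by (simp add: q_def power_mult_distrib power_mult[symmetric] mult.commute)
  show ?thesis
  proof (cases "j = k")
    case True
    then have "q = 1" using unit by (simp add: q_def)
    then show ?thesis using True sum by simp
  next
    case False
    have "q \<noteq> 1"
    proof
      assume "q = 1"
      then have "\<zeta> ^ j = (cnj (\<zeta> ^ j) * \<zeta> ^ k) * \<zeta> ^ j" by (simp add: q_def)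
      also have "\<dots> = \<zeta> ^ k" using unit[of j] by (metis mult.assoc mult.commute mult_1)
      finally have "cis (2 * pi * real j / real K) = cis (2 * pi * real k / real K)" by (simp add: root)
      then show False
        using Complex.bij_betw_roots_unity[of K] assms(1,2) False by (auto simp: bij_betw_def inj_on_def)
    qed
    then show ?thesis using False sum qK by (simp add: geometric_sum)
  qed
qed

text \<open>Since \<open>Suc k \<le> 2 ^ Suc k\<close>, a geometric sum of ratio \<open>1/4\<close>
  dominates. The terms combine perturbations of size \<open>(1/8) ^ Suc k\<close>, coefficients up
  to \<open>2\<close> and the weights from \<open>kp_sum\<close>.\<close>

lemma sum_weighted_geometric_le: "(\<Sum>k<n. real (Suc k) * (2 * (1/8) ^ Suc k)) \<le> (1::real)"
proof -
  have "real (Suc k) * (2 * (1/8) ^ Suc k) \<le> 2 * (1/4) ^ Suc k" for k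
  proof -
    have "real (Suc k) \<le> 2 ^ Suc k" using of_nat_less_two_power[of "Suc k", where 'a=real] by simp
    then have "real (Suc k) * (2 * (1/8) ^ Suc k) \<le> 2 ^ Suc k * (2 * (1/8) ^ Suc k)"
      by (intro mult_right_mono) auto
    also have "\<dots> = 2 * (1/4) ^ Suc k"
      by (simp only: mult.left_commute[of _ 2] power_mult_distrib[symmetric]) simp
    finally show ?thesis .
  qed
  then have "(\<Sum>k<n. real (Suc k) * (2 * (1/8) ^ Suc k)) \<le> (\<Sum>k<n. 2 * (1/4::real) ^ Suc k)"
    by (rule sum_mono)
  also have "\<dots> = 2/3 * (1 - (1/4) ^ n)" by (induction n) (simp_all add: algebra_simps)
  also have "\<dots> \<le> 1"
  proof -
    have *: "2/3 * (1 - q) \<le> 1" if "0 \<le> q" for q :: real using that by simp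
    show ?thesis by (rule *) simp
  qed
  finally show ?thesis .
qed

section \<open>Passage to disjoint blocks and diagonalisation\<close>

context unconditional_basis
begin

text \<open>
  The perturbations \<open>w k - u k\<close> need not be mapped into \<open>X\<close> by the Kalton--Peck map, however small they
  are; this is why their images are absorbed into the linear map.
\<close>

lemma perturbation:
  assumes lip: "L-lipschitz_on {0..} \<phi>"
    and sub: "subspace W" and lin: "linear_into_sequences scl W l"
    and triv: "\<And>x. x \<in> W \<Longrightarrow> in_ball (C * norm x) (\<lambda>m. kalton_peck scl e \<phi> x m - l x m)"
    and w: "\<And>k. w k \<in> W"
    and small: "\<And>k. norm (w k - u k) \<le> (1/8) ^ Suc k"
    and a: "\<And>k. k < K \<Longrightarrow> cmod (a k) \<le> 2"
    and norm1: "norm (\<Sum>k<K. scl (a k) (u k)) \<le> 1"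
  shows "in_ball (12 * L + 2 * \<bar>C\<bar>) (\<lambda>m. kp \<phi> (co (\<Sum>k<K. scl (a k) (u k)) m) -
      (\<Sum>k<K. a k * (l (w k) m - kp \<phi> (co (w k - u k) m))))"
proof -
  have L: "L \<ge> 0" using lip by (rule lipschitz_on_nonneg)
  define d where "d k = w k - u k" for k
  define xu where "xu = (\<Sum>k<K. scl (a k) (u k))"
  define xd where "xd = (\<Sum>k<K. scl (a k) (d k))"
  define x where "x = (\<Sum>k<K. scl (a k) (w k))"
  have x: "x = xu + xd"
    by (simp add: x_def xu_def xd_def d_def sum.distrib[symmetric] scale_right_distrib[symmetric])
  have nd: "norm (scl (a k) (d k)) \<le> 2 * (1/8) ^ Suc k" if "k < K" for k
    unfolding norm_scl using a[OF that] small[of k] by (intro mult_mono) (auto simp: d_def)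
  have nd': "norm (scl (a k) (d k)) \<le> real (Suc k) * (2 * (1/8) ^ Suc k)" if "k < K" for k
  proof -
    have "1 * (2 * (1/8) ^ Suc k) \<le> real (Suc k) * (2 * (1/8::real) ^ Suc k)"
      by (intro mult_right_mono) auto
    with nd[OF that] show ?thesis by linarith
  qed
  have "norm xd \<le> (\<Sum>k<K. norm (scl (a k) (d k)))" unfolding xd_def by (rule norm_sum)
  also have "\<dots> \<le> (\<Sum>k<K. real (Suc k) * (2 * (1/8) ^ Suc k))" using nd' by (intro sum_mono) auto
  also have "\<dots> \<le> 1" by (rule sum_weighted_geometric_le)
  finally have nxd: "norm xd \<le> 1" .
  have nxu: "norm xu \<le> 1" using norm1 by (simp add: xu_def)
  have nx: "norm x \<le> 2" using norm_triangle_ineq[of xu xd] nxd nxu by (simp add: x)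
  have xW: "x \<in> W" unfolding x_def using sub w by (intro subspace_sum subspace_scale)
  have lx: "l x m = (\<Sum>k<K. a k * l (w k) m)" for m
  proof -
    \<comment> \<open>Homogeneity with factor \<open>0\<close> forces \<open>l 0\<close> to vanish,
      which is the base case for finite sums.\<close>
    have "l 0 m = 0 * l 0 m"
      using lin subspace_0[OF sub] unfolding linear_into_sequences_def
      by (metis scale_zero_left)
    then have "l (\<Sum>k<n. scl (a k) (w k)) m = (\<Sum>k<n. a k * l (w k) m)" for n
    proof (induction n)
      case (Suc n)
      have "(\<Sum>k<n. scl (a k) (w k)) \<in> W" "scl (a n) (w n) \<in> W"
        using sub w by (auto intro: subspace_sum subspace_scale)
      then show ?case using Suc lin w unfolding linear_into_sequences_def by simp
    qed simp
    then show ?thesis by (simp add: x_def)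
  qed
  \<comment> \<open>Five comparisons follow: \<open>kp\<close> at \<open>x\<close> with the
    Kalton-Peck value, that value with \<open>l x\<close>, \<open>kp\<close> at \<open>x\<close>
    with its values at \<open>xu\<close> and \<open>xd\<close>, the value at \<open>xd\<close> with
    the sum over its terms, and this sum with the one where the coefficients are pulled out.\<close>
  let ?kpx = "\<lambda>m. kp \<phi> (co x m)" and ?kpu = "\<lambda>m. kp \<phi> (co xu m)" and ?kpd = "\<lambda>m. kp \<phi> (co xd m)"
  have b1: "in_ball (2 * L) (\<lambda>m. ?kpx m - kalton_peck scl e \<phi> x m)"
    using kalton_peck_kp[OF lip nx] .
  have "C * norm x \<le> \<bar>C\<bar> * 2" using nx by (intro mult_mono) auto
  then have b2: "in_ball (2 * \<bar>C\<bar>) (\<lambda>m. kalton_peck scl e \<phi> x m - l x m)"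
    by (intro in_ball_mono[OF triv[OF xW] order_refl]) simp
  have "in_ball (3 * L * (norm xu + norm xd)) (\<lambda>m. ?kpx m - ?kpu m - ?kpd m)"
    using L kp_add[OF lip] by (intro in_ball_le_add) (auto simp: x coord_add)
  then have b3: "in_ball (6 * L) (\<lambda>m. ?kpx m - ?kpu m - ?kpd m)"
  proof (rule in_ball_mono[OF _ order_refl])
    show "3 * L * (norm xu + norm xd) \<le> 6 * L"
      using L nxu nxd mult_left_mono[of "norm xu + norm xd" 2 "3 * L"] by simp
  qed
  have "in_ball (\<Sum>k<K. 3 * L * real (Suc k) * norm (scl (a k) (d k)))
      (\<lambda>m. ?kpd m - (\<Sum>k<K. kp \<phi> (co (scl (a k) (d k)) m)))"
    using L kp_sum[OF lip, of "\<lambda>k. co (scl (a k) (d k)) _" K]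
    by (intro in_ball_le_sum) (auto simp: xd_def coord_sum)
  then have b4: "in_ball (3 * L) (\<lambda>m. ?kpd m - (\<Sum>k<K. kp \<phi> (co (scl (a k) (d k)) m)))"
  proof (rule in_ball_mono[OF _ order_refl])
    have "(\<Sum>k<K. 3 * L * real (Suc k) * norm (scl (a k) (d k))) \<le>
        (\<Sum>k<K. 3 * L * (real (Suc k) * (2 * (1/8) ^ Suc k)))"
      using nd L by (intro sum_mono) (auto simp only: mult.assoc intro!: mult_left_mono)
    also have "\<dots> = 3 * L * (\<Sum>k<K. real (Suc k) * (2 * (1/8) ^ Suc k))"
      by (rule sum_distrib_left[symmetric])
    also have "\<dots> \<le> 3 * L * 1"
      using L by (intro mult_left_mono sum_weighted_geometric_le) auto
    finally show "(\<Sum>k<K. 3 * L * real (Suc k) * norm (scl (a k) (d k))) \<le> 3 * L" by simp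
  qed
  have "cmod ((\<Sum>k<K. kp \<phi> (co (scl (a k) (d k)) m)) - (\<Sum>k<K. a k * kp \<phi> (co (d k) m)))
      \<le> (\<Sum>k<K. 2 * L * cmod (co (d k) m))" for m
    unfolding sum_subtractf[symmetric]
  proof (rule sum_norm_le)
    fix k assume "k \<in> {..<K}"
    then have "cmod (a k) * \<bar>ln (cmod (a k))\<bar> \<le> 2" using a by (intro mult_abs_ln_le) auto
    then have "L * (cmod (a k) * \<bar>ln (cmod (a k))\<bar>) * cmod (co (d k) m) \<le> L * 2 * cmod (co (d k) m)"
      using L by (intro mult_right_mono mult_left_mono) auto
    with kp_mult[OF lip, of "a k" "co (d k) m"]
    show "cmod (kp \<phi> (co (scl (a k) (d k)) m) - a k * kp \<phi> (co (d k) m)) \<le> 2 * L * cmod (co (d k) m)"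
      by (simp add: coord_scl mult.commute)
  qed
  then have "in_ball (\<Sum>k<K. 2 * L * norm (d k))
      (\<lambda>m. (\<Sum>k<K. kp \<phi> (co (scl (a k) (d k)) m)) - (\<Sum>k<K. a k * kp \<phi> (co (d k) m)))"
    using L by (intro in_ball_le_sum) auto
  then have b5: "in_ball L (\<lambda>m. (\<Sum>k<K. kp \<phi> (co (scl (a k) (d k)) m)) - (\<Sum>k<K. a k * kp \<phi> (co (d k) m)))"
  proof (rule in_ball_mono[OF _ order_refl])
    have "2 * norm (d k) \<le> real (Suc k) * (2 * (1/8) ^ Suc k)" for k
    proof -
      have "1 * (2 * (1/8) ^ Suc k) \<le> real (Suc k) * (2 * (1/8::real) ^ Suc k)"
        by (intro mult_right_mono) auto
      with small[of k] show ?thesis unfolding d_def by linarith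
    qed
    then have "(\<Sum>k<K. 2 * L * norm (d k)) \<le> (\<Sum>k<K. L * (real (Suc k) * (2 * (1/8) ^ Suc k)))"
      using L by (intro sum_mono) (simp add: mult_left_mono mult.assoc mult.left_commute[of 2])
    also have "\<dots> = L * (\<Sum>k<K. real (Suc k) * (2 * (1/8) ^ Suc k))"
      by (rule sum_distrib_left[symmetric])
    also have "\<dots> \<le> L * 1"
      using L by (intro mult_left_mono sum_weighted_geometric_le) auto
    finally show "(\<Sum>k<K. 2 * L * norm (d k)) \<le> L" by simp
  qed
  \<comment> \<open>The errors \<open>2 * L\<close>, \<open>2 * \<bar>C\<bar>\<close>,
    \<open>6 * L\<close>, \<open>3 * L\<close> and \<open>L\<close> add up to the stated
    constant.\<close>
  from in_ball_diff[OF in_ball_diff[OF in_ball_diff[OF in_ball_add[OF b1 b2] b3] b4] b5]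
  have "in_ball (12 * L + 2 * \<bar>C\<bar>) (\<lambda>m. ?kpu m - l x m + (\<Sum>k<K. a k * kp \<phi> (co (d k) m)))"
    by (simp add: algebra_simps)
  then show ?thesis
    by (simp add: lx xu_def d_def right_diff_distrib sum_subtractf algebra_simps)
qed

text \<open>Only the block numbered \<open>b m\<close> can meet the coordinate \<open>m\<close>.
  Coordinates outside all supports also carry a number, and there the formula gives
  \<open>0\<close>.\<close>

lemma coord_block_sum:
  fixes K :: nat
  assumes "\<And>k m. co (u k) m \<noteq> 0 \<Longrightarrow> b m = k"
  shows "co (\<Sum>k<K. scl (c k) (u k)) m = (if b m < K then c (b m) * co (u (b m)) m else 0)"
proof -
  have "co (\<Sum>k<K. scl (c k) (u k)) m = (\<Sum>k<K. if k = b m then c k * co (u k) m else 0)"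
    unfolding coord_sum coord_scl using assms[of _ m] by (intro sum.cong) auto
  then show ?thesis by simp
qed

text \<open>
  Conjugating by the diagonal multipliers that equal \<open>\<zeta>\<^sup>r\<^sup>k\<close> on the \<open>k\<close>-th block, for \<open>\<zeta>\<close> a
  \<open>K\<close>-th root of unity, and averaging over \<open>r\<close> kills the off-diagonal part of a linear map.
\<close>

lemma diagonalisation:
  fixes K :: nat
  assumes disj: "\<And>k m. co (u k) m \<noteq> 0 \<Longrightarrow> b m = k"
    and bound: "\<And>c. (\<And>k. cmod (c k) = cmod (a k)) \<Longrightarrow> in_ball B
      (\<lambda>m. kp \<phi> (co (\<Sum>k<K. scl (c k) (u k)) m) - (\<Sum>k<K. c k * h k m))"
  shows "in_ball B (\<lambda>m. kp \<phi> (co (\<Sum>k<K. scl (a k) (u k)) m) -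
      h (b m) m / co (u (b m)) m * co (\<Sum>k<K. scl (a k) (u k)) m)"
proof (cases "K = 0")
  case True
  then show ?thesis using bound[of a] by simp
next
  case False
  define \<zeta> where "\<zeta> = cis (2 * pi / K)"
  have unit: "cmod (\<zeta> ^ i) = 1" for i by (simp add: \<zeta>_def norm_power)
  note single = coord_block_sum[OF disj]
  define F where "F r m = kp \<phi> (co (\<Sum>k<K. scl (\<zeta> ^ (r * k) * a k) (u k)) m) -
      (\<Sum>k<K. \<zeta> ^ (r * k) * a k * h k m)" for r m
  \<comment> \<open>The phase put on block \<open>b m\<close> is undone. Where
    \<open>u (b m)\<close> vanishes the value \<open>0\<close> is chosen, which agrees with the
    target there.\<close>
  define G where "G r m = (if b m < K \<and> co (u (b m)) m \<noteq> 0 then cnj (\<zeta> ^ (r * b m)) * F r m else 0)" for r m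
  have "in_ball B (F r)" for r
    unfolding F_def using bound[of "\<lambda>k. \<zeta> ^ (r * k) * a k"] by (simp add: norm_mult unit)
  then have "in_ball B (G r)" for r
    by (rule in_ball_mono[OF _ _ order_refl, of _ "F r"])
      (auto simp: G_def norm_mult unit simp del: complex_cnj_power)
  then have "in_ball (\<Sum>r<K. B) (\<lambda>m. \<Sum>r<K. G r m)" by (intro in_ball_sum) auto
  then have "in_ball B (\<lambda>m. of_real (1 / K) * (\<Sum>r<K. G r m))"
    by (rule in_ball_scale) (use False in \<open>simp add: norm_divide\<close>)
  moreover have "of_real (1 / K) * (\<Sum>r<K. G r m) = kp \<phi> (co (\<Sum>k<K. scl (a k) (u k)) m) -
      h (b m) m / co (u (b m)) m * co (\<Sum>k<K. scl (a k) (u k)) m" for m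
  proof (cases "b m < K \<and> co (u (b m)) m \<noteq> 0")
    case True
    define j where "j = b m"
    have j: "j < K" "co (u j) m \<noteq> 0" using True by (auto simp: j_def)
    define t where "t = a j * co (u j) m"
    have "G r m = kp \<phi> t - (\<Sum>k<K. cnj (\<zeta> ^ (r * j)) * \<zeta> ^ (r * k) * (a k * h k m))" for r
    proof -
      have "kp \<phi> (co (\<Sum>k<K. scl (\<zeta> ^ (r * k) * a k) (u k)) m) = kp \<phi> (\<zeta> ^ (r * j) * t)"
        using True by (simp add: single j_def t_def mult.assoc)
      also have "\<dots> = \<zeta> ^ (r * j) * kp \<phi> t" by (rule kp_unimodular[OF unit])
      finally have "G r m = (cnj (\<zeta> ^ (r * j)) * \<zeta> ^ (r * j)) * kp \<phi> t -
          cnj (\<zeta> ^ (r * j)) * (\<Sum>k<K. \<zeta> ^ (r * k) * a k * h k m)"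
        using True unfolding G_def F_def j_def by (simp only: if_True simp_thms right_diff_distrib mult.assoc)
      also have "cnj (\<zeta> ^ (r * j)) * \<zeta> ^ (r * j) = 1"
        using complex_norm_square[of "\<zeta> ^ (r * j)"] unit[of "r * j"] by (simp add: mult.commute)
      finally show ?thesis by (simp only: sum_distrib_left mult.assoc mult_1)
    qed
    then have "(\<Sum>r<K. G r m) = of_nat K * kp \<phi> t -
        (\<Sum>r<K. \<Sum>k<K. cnj (\<zeta> ^ (r * j)) * \<zeta> ^ (r * k) * (a k * h k m))"
      by (simp only: sum_subtractf) simp
    also have "(\<Sum>r<K. \<Sum>k<K. cnj (\<zeta> ^ (r * j)) * \<zeta> ^ (r * k) * (a k * h k m)) =
        (\<Sum>k<K. (\<Sum>r<K. cnj (\<zeta> ^ (r * j)) * \<zeta> ^ (r * k)) * (a k * h k m))"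
      by (subst sum.swap) (simp only: sum_distrib_right)
    \<comment> \<open>By orthogonality only the diagonal term survives the averaging.\<close>
    also have "\<dots> = (\<Sum>k<K. if j = k then of_nat K * (a k * h k m) else 0)"
      using roots_of_unity_orthogonal[OF j(1)] unfolding \<zeta>_def by (intro sum.cong) auto
    also have "\<dots> = of_nat K * (a j * h j m)" using j(1) by simp
    finally have "of_real (1 / K) * (\<Sum>r<K. G r m) = kp \<phi> t - a j * h j m"
      using False by (simp add: field_simps)
    then show ?thesis using True by (simp add: single j_def t_def)
  next
    case c: False
    then have "G r m = 0" for r unfolding G_def by (rule if_not_P)
    moreover have "co (\<Sum>k<K. scl (a k) (u k)) m = 0" using c by (auto simp: single)
    ultimately show ?thesis by simp
  qed
  ultimately show ?thesis by simp
qed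

text \<open>The multiplier \<open>g\<close> is, on the \<open>k\<close>-th block, the corrected
  linear image of \<open>u k\<close> divided coordinatewise by \<open>u k\<close>. Division by zero
  is harmless, since the quotient is then multiplied by a zero coordinate.\<close>

lemma trivial_on_diagonal:
  assumes lip: "L-lipschitz_on {0..} \<phi>"
    and W: "subspace W" "\<not> (\<exists>B. finite B \<and> W = span B)"
    and triv: "trivial_on scl e (kalton_peck scl e \<phi>) W"
  obtains u b g B and p :: "nat \<Rightarrow> nat"
  where "disjoint_sequence scl e u" "strict_mono p" "\<And>m K. m < p K \<longleftrightarrow> b m < K"
    "\<And>k m. co (u k) m \<noteq> 0 \<Longrightarrow> b m = k"
    "\<And>K a. norm (\<Sum>k<K::nat. scl (a k) (u k)) \<le> 1 \<Longrightarrow>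
      in_ball B (\<lambda>m. kp \<phi> (co (\<Sum>k<K. scl (a k) (u k)) m) - g m * co (\<Sum>k<K. scl (a k) (u k)) m)"
proof -
  obtain l C where lin: "linear_into_sequences scl W l"
    and C: "\<And>x. x \<in> W \<Longrightarrow> in_ball (C * norm x) (\<lambda>m. kalton_peck scl e \<phi> x m - l x m)"
    using triv unfolding trivial_on_def in_ball_def fun_eq_iff by blast
  obtain p w where p: "p 0 = 0" "strict_mono p" and w: "\<And>k. w k \<in> W" "\<And>k. norm (w k) = 1"
      "\<And>k m. m < p k \<Longrightarrow> co (w k) m = 0"
      "\<And>k. norm (w k - trunc (p (Suc k)) (w k)) \<le> (1/8) ^ Suc k"
    using gliding_hump[OF W, of "\<lambda>k. (1/8) ^ Suc k"] by auto
  define u where "u k = trunc (p (Suc k)) (w k)" for k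
  \<comment> \<open>As \<open>p\<close> starts at \<open>0\<close> and is unbounded, every
    coordinate lies in exactly one interval from \<open>p k\<close> to \<open>p (Suc k)\<close>;
    \<open>b\<close> is its number.\<close>
  define b where "b m = (LEAST k. m < p (Suc k))" for m
  have b: "m < p K \<longleftrightarrow> b m < K" for m K
  proof
    assume "m < p K"
    then obtain K' where "K = Suc K'" using p(1) by (cases K) auto
    with \<open>m < p K\<close> show "b m < K" unfolding b_def by (simp add: Least_le less_Suc_eq_le)
  next
    have "m < p (Suc m)" using seq_suble[OF p(2), of "Suc m"] by simp
    then have "m < p (Suc (b m))" unfolding b_def by (rule LeastI)
    also assume "b m < K"
    then have "p (Suc (b m)) \<le> p K" using strict_mono_less_eq[OF p(2)] by simp
    finally show "m < p K" .
  qed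
  have disj: "b m = k" if "co (u k) m \<noteq> 0" for k m
  proof -
    have "m < p (Suc k)" "\<not> m < p k" using that w(3)[of m k] by (auto simp: u_def coord_trunc split: if_splits)
    then show ?thesis by (simp add: b)
  qed
  \<comment> \<open>For combinations of norm at most \<open>1\<close> this lower bound keeps the
    coefficients at most \<open>2\<close>, as \<open>perturbation\<close> requires.\<close>
  have nu: "norm (u k) \<ge> 1/2" for k
  proof -
    have "norm (w k - u k) \<le> 1/8 * (1/8) ^ k" using w(4)[of k] by (simp add: u_def)
    also have "\<dots> \<le> 1/8 * 1" by (intro mult_left_mono power_le_one) auto
    finally show ?thesis using norm_triangle_ineq2[of "w k" "u k"] w(2)[of k] by simp
  qed
  show ?thesis
  proof (rule that[of u p b, OF _ p(2) b disj])
    have "u k \<noteq> 0" for k using nu[of k] by auto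
    then show "disjoint_sequence scl e u"
      using disj unfolding disjoint_sequence_def disjoint_family_on_def supp_def by blast
    fix K a
    assume n1: "norm (\<Sum>k<K::nat. scl (a k) (u k)) \<le> 1"
    show "in_ball (12 * L + 2 * \<bar>C\<bar>) (\<lambda>m. kp \<phi> (co (\<Sum>k<K. scl (a k) (u k)) m) -
      (l (w (b m)) m - kp \<phi> (co (w (b m) - u (b m)) m)) / co (u (b m)) m * co (\<Sum>k<K. scl (a k) (u k)) m)"
    proof (rule diagonalisation[OF disj])
      fix c assume c: "\<And>k. cmod (c k) = cmod (a k)"
      \<comment> \<open>Changing phases leaves all moduli of coordinates unchanged, so one norm
        bound serves for every \<open>c\<close>.\<close>
      have n2: "norm (\<Sum>k<K. scl (c k) (u k)) \<le> 1"
        using n1 by (intro order_trans[OF norm_mono n1])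
          (auto simp: coord_block_sum[of u b, OF disj] norm_mult c)
      show "in_ball (12 * L + 2 * \<bar>C\<bar>) (\<lambda>m. kp \<phi> (co (\<Sum>k<K. scl (c k) (u k)) m) -
          (\<Sum>k<K. c k * (l (w k) m - kp \<phi> (co (w k - u k) m))))"
      proof (rule perturbation[OF lip W(1) lin C w(1) _ _ n2])
        show "norm (w k - u k) \<le> (1/8) ^ Suc k" for k using w(4) by (simp only: u_def)
        fix k assume "k < K"
        then have "norm (scl (c k) (u k)) \<le> norm (\<Sum>k<K. scl (c k) (u k))"
        proof (intro norm_mono)
          fix m
          show "cmod (co (scl (c k) (u k)) m) \<le> cmod (co (\<Sum>k<K. scl (c k) (u k)) m)"
            using \<open>k < K\<close> disj[of k m]
            by (cases "co (u k) m = 0") (auto simp: coord_block_sum[of u b, OF disj] coord_scl)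
        qed
        with n2 have "cmod (c k) * norm (u k) \<le> 1" by (simp add: norm_scl)
        moreover have "cmod (c k) * (1/2) \<le> cmod (c k) * norm (u k)"
          using nu[of k] by (intro mult_left_mono) auto
        ultimately show "cmod (c k) \<le> 2" by simp
      qed
    qed
  qed
qed

section \<open>Block subspaces and the function \<open>M_fun\<close>\<close>

text \<open>
  Being proportional to \<open>u k\<close> on each block is a closed condition on coordinates.
\<close>

lemma trunc_closure_span:
  assumes "\<And>k. u k \<noteq> 0" and b: "\<And>m K. m < p K \<longleftrightarrow> b m < (K::nat)"
    and disj: "\<And>k m. co (u k) m \<noteq> 0 \<Longrightarrow> b m = k"
    and y: "y \<in> closure (span (range u))"
  shows "\<exists>a. \<forall>K. trunc (p K) y = (\<Sum>k<K. scl (a k) (u k))"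
proof -
  \<comment> \<open>Proportionality is cross-multiplied, which makes it linear in \<open>x\<close>
    and meaningful where \<open>u\<close> vanishes.\<close>
  define T where "T = {x. \<forall>m m'. b m = b m' \<longrightarrow> co x m * co (u (b m)) m' = co x m' * co (u (b m)) m}"
  have "T = (\<Inter>m. \<Inter>m'\<in>{m'. b m = b m'}. {x. co x m * co (u (b m)) m' = co x m' * co (u (b m)) m})"
    by (auto simp: T_def)
  also have "closed \<dots>"
    by (intro closed_INT ballI closed_Collect_eq continuous_intros continuous_on_coord)
  finally have "closed T" .
  moreover have "subspace T"
    by (auto simp: T_def subspace_def coord_add coord_scl distrib_right
        intro!: arg_cong2[where f = "(+)"])
  moreover have "range u \<subseteq> T"
  proof -
    have "co (u k) m * co (u (b m)) m' = co (u k) m' * co (u (b m)) m" if "b m = b m'" for k m m'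
    proof (cases "b m = k")
      case False
      then have "co (u k) m = 0" "co (u k) m' = 0" using disj that by metis+
      then show ?thesis by simp
    qed (use that in auto)
    then show ?thesis by (auto simp: T_def)
  qed
  ultimately have "closure (span (range u)) \<subseteq> T" by (intro closure_minimal span_minimal)
  with y have "y \<in> T" by blast
  have "\<exists>m. co (u k) m \<noteq> 0" for k
    using assms(1)[of k] coord_inject[of "u k" 0] by auto
  \<comment> \<open>The coefficient of the \<open>k\<close>-th block is read off at the coordinate
    \<open>\<mu> k\<close>.\<close>
  then obtain \<mu> where \<mu>: "\<And>k. co (u k) (\<mu> k) \<noteq> 0" by metis
  then have b\<mu>: "b (\<mu> k) = k" for k using disj by blast
  have "trunc (p K) y = (\<Sum>k<K. scl (co y (\<mu> k) / co (u k) (\<mu> k)) (u k))" for K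
  proof (rule coord_inject)
    fix m
    have "co y m * co (u (b m)) (\<mu> (b m)) = co y (\<mu> (b m)) * co (u (b m)) m"
      using \<open>y \<in> T\<close> b\<mu>[of "b m"] by (simp add: T_def)
    then have "co y m = co y (\<mu> (b m)) / co (u (b m)) (\<mu> (b m)) * co (u (b m)) m"
      using \<mu>[of "b m"] by (simp add: field_simps)
    then show "co (trunc (p K) y) m =
        co (\<Sum>k<K. scl (co y (\<mu> k) / co (u k) (\<mu> k)) (u k)) m"
      by (simp add: coord_trunc coord_block_sum[of u b, OF disj] b)
  qed
  then show ?thesis by (intro exI allI)
qed

text \<open>Rescaling by \<open>1 / C\<close> keeps the supports. The triangle inequality bounds the
  defining set, so the real supremum is an upper bound.\<close>

lemma norm_sum_le_M_fun:
  assumes "\<And>i. i < n \<Longrightarrow> norm (y i) \<le> C" "C > 0"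
    and "disjoint_family_on (\<lambda>i. supp scl e (y i)) {..<n}"
  shows "norm (\<Sum>i<n. y i) \<le> C * M_fun scl e UNIV n"
proof -
  let ?S = "{norm (\<Sum>i<n. x i) | x. (\<forall>i<n. x i \<in> UNIV \<and> norm (x i) \<le> 1) \<and>
                                disjoint_family_on (\<lambda>i. supp scl e (x i)) {..<n}}"
  let ?y = "\<lambda>i. scl (of_real (1 / C)) (y i)"
  have "bdd_above ?S"
  proof (rule bdd_aboveI, clarify)
    fix x :: "nat \<Rightarrow> 'a" assume x: "\<forall>i<n. x i \<in> UNIV \<and> norm (x i) \<le> 1"
    have "norm (\<Sum>i<n. x i) \<le> (\<Sum>i<n. norm (x i))" by (rule norm_sum)
    also have "\<dots> \<le> (\<Sum>i<n. 1)" using x by (intro sum_mono) auto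
    finally show "norm (\<Sum>i<n. x i) \<le> real n" by simp
  qed
  moreover have "norm (\<Sum>i<n. ?y i) \<in> ?S"
  proof -
    have "supp scl e (?y i) = supp scl e (y i)" for i
      using assms(2) by (simp add: supp_def coord_scl)
    moreover have "norm (?y i) \<le> 1" if "i < n" for i
      using assms(1)[OF that] assms(2) by (simp add: norm_scl norm_divide)
    ultimately show ?thesis using assms(3) by auto
  qed
  ultimately have "norm (\<Sum>i<n. ?y i) \<le> M_fun scl e UNIV n"
    unfolding M_fun_def by (intro cSup_upper)
  moreover have "norm (\<Sum>i<n. y i) = C * norm (\<Sum>i<n. ?y i)"
    unfolding scale_sum_right[symmetric] norm_scl using assms(2) by (simp add: norm_divide)
  ultimately show ?thesis using assms(2) by (simp only: mult_left_mono less_imp_le)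
qed

lemma M_fun_approx:
  assumes "0 \<in> V" "r < M_fun scl e V n"
  obtains x where "\<And>i. i < n \<Longrightarrow> x i \<in> V" "\<And>i. i < n \<Longrightarrow> norm (x i) \<le> 1"
    "disjoint_family_on (\<lambda>i. supp scl e (x i)) {..<n}" "r < norm (\<Sum>i<n. x i)"
proof -
  let ?S = "{norm (\<Sum>i<n. x i) | x. (\<forall>i<n. x i \<in> V \<and> norm (x i) \<le> 1) \<and>
                                disjoint_family_on (\<lambda>i. supp scl e (x i)) {..<n}}"
  have "norm (\<Sum>i<n. 0 :: 'a) \<in> ?S"
    using assms(1) by (intro CollectI exI[of _ "\<lambda>_. 0"]) (auto simp: disjoint_family_on_def supp_def)
  then have ne: "?S \<noteq> {}" by (rule ex_in_conv[THEN iffD1, OF exI])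
  have "r < Sup ?S" using assms(2) by (simp only: M_fun_def)
  then obtain s where s: "s \<in> ?S" "r < s" using ne by (rule less_cSupE)
  from s(1) obtain x where x: "s = norm (\<Sum>i<n. x i)" "\<forall>i<n. x i \<in> V \<and> norm (x i) \<le> 1"
    "disjoint_family_on (\<lambda>i. supp scl e (x i)) {..<n}"
    by (elim CollectE exE conjE)
  show ?thesis using x(2) x(3) s(2)[unfolded x(1)] by (intro that[of x]) simp_all
qed

end

text \<open>The positive lower limit makes the quotient eventually positive; as \<open>f\<close> is
  eventually positive too, so is \<open>g\<close>, and the upper limit can be multiplied
  out.\<close>

lemma asymp_equiv_const_eventually_le:
  assumes "asymp_equiv_const f g" "filterlim f at_top sequentially"
  obtains B where "B > 0" "eventually (\<lambda>n. 0 < g n \<and> f n \<le> B * g n) sequentially"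
proof -
  obtain c where "limsup (\<lambda>n. ereal (f n / g n)) < ereal c"
    using assms(1) ereal_dense2 unfolding asymp_equiv_const_def by blast
  then have up: "eventually (\<lambda>n. ereal (f n / g n) < ereal c) sequentially"
    by (rule Limsup_lessD)
  have lo: "eventually (\<lambda>n. 0 < ereal (f n / g n)) sequentially"
    using assms(1) unfolding asymp_equiv_const_def by (intro less_LiminfD) auto
  have pos: "eventually (\<lambda>n. f n > 0) sequentially"
    using assms(2) by (simp add: filterlim_at_top_dense)
  show ?thesis
  proof
    show "max c 1 > 0" by simp
    show "eventually (\<lambda>n. 0 < g n \<and> f n \<le> max c 1 * g n) sequentially"
      using up lo pos
    proof eventually_elim
      case (elim n)
      then have g: "0 < g n" by (simp add: zero_less_divide_iff)
      with elim have "f n < c * g n" by (simp add: divide_less_eq)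
      also have "\<dots> \<le> max c 1 * g n" using g by (intro mult_right_mono) auto
      finally show ?case using g by simp
    qed
  qed
qed

section \<open>Self-similarity against expansiveness\<close>

theorem proposition6p6:
  fixes scl :: "complex \<Rightarrow> 'a::banach \<Rightarrow> 'a"
    and e :: "nat \<Rightarrow> 'a"
    and \<phi> :: "real \<Rightarrow> complex"
  assumes "complex_banach scl"
    and "normalized_unconditional_basis scl e"
    and "self_similar scl e"
    and "filterlim (M_fun scl e UNIV) at_top sequentially"
    and "expansive \<phi>"
  shows "singular scl e (kalton_peck scl e \<phi>)"
proof -
  interpret complex_banach scl by fact
  interpret unconditional_basis scl e by unfold_locales fact
  have "\<not> trivial_on scl e (kalton_peck scl e \<phi>) W"
    if W: "subspace W" "\<not> (\<exists>B. finite B \<and> W = span B)" for W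
  proof
    assume triv: "trivial_on scl e (kalton_peck scl e \<phi>) W"
    obtain L where lip: "L-lipschitz_on {0..} \<phi>" using assms(5) by (auto simp: expansive_def)
    obtain u b g C0 and p :: "nat \<Rightarrow> nat"
      where u: "disjoint_sequence scl e u" and p: "strict_mono p" and b: "\<And>m K. m < p K \<longleftrightarrow> b m < K"
        and disj: "\<And>k m. co (u k) m \<noteq> 0 \<Longrightarrow> b m = k"
        and C0: "\<And>K a. norm (\<Sum>k<K::nat. scl (a k) (u k)) \<le> 1 \<Longrightarrow>
          in_ball C0 (\<lambda>m. kp \<phi> (co (\<Sum>k<K. scl (a k) (u k)) m) - g m * co (\<Sum>k<K. scl (a k) (u k)) m)"
      by (rule trivial_on_diagonal[OF lip W triv], rule that, assumption+)
    define C where "C = max C0 1"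
    define Y where "Y = closure (span (range u))"
    \<comment> \<open>The estimate holds for finite combinations of blocks, whereas the supremum for
      \<open>Y\<close> runs over a closure; nearly extremal vectors will be truncated into some
      \<open>S K\<close>.\<close>
    define S where "S K = {x. \<exists>a. x = (\<Sum>k<K. scl (a k) (u k))}" for K :: nat
    have C: "in_ball C (\<lambda>m. kp \<phi> (co x m) - g m * co x m)" if x: "x \<in> S K" "norm x \<le> 1" for x K
    proof -
      obtain a where a: "x = (\<Sum>k<K. scl (a k) (u k))" using x(1) unfolding S_def by (elim CollectE exE)
      show ?thesis
        unfolding a by (rule in_ball_mono[OF C0 order_refl]) (use x(2) a in \<open>simp_all add: C_def\<close>)
    qed
    have S_sum: "(\<Sum>i\<in>I. x i) \<in> S K" if "\<And>i. i \<in> I \<Longrightarrow> x i \<in> S K" for x K and I :: "nat set"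
    proof -
      have "\<forall>i\<in>I. \<exists>a. x i = (\<Sum>k<K. scl (a k) (u k))"
        using that unfolding S_def by simp
      then obtain a where a: "\<forall>i\<in>I. x i = (\<Sum>k<K. scl (a i k) (u k))"
        unfolding bchoice_iff by (elim exE)
      then have "(\<Sum>i\<in>I. x i) = (\<Sum>i\<in>I. \<Sum>k<K. scl (a i k) (u k))" by simp
      also have "\<dots> = (\<Sum>k<K. \<Sum>i\<in>I. scl (a i k) (u k))" by (rule sum.swap)
      also have "\<dots> = (\<Sum>k<K. scl (\<Sum>i\<in>I. a i k) (u k))" by (simp only: scale_sum_left)
      finally show ?thesis unfolding S_def by (intro CollectI exI)
    qed
    have S_scl: "scl c x \<in> S K" if x: "x \<in> S K" for c x K
    proof -
      obtain a where "x = (\<Sum>k<K. scl (a k) (u k))" using x unfolding S_def by (elim CollectE exE)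
      then have "scl c x = (\<Sum>k<K. scl (c * a k) (u k))" by (simp add: scale_sum_right)
      then show ?thesis unfolding S_def by (intro CollectI exI)
    qed
    have "asymp_equiv_const (M_fun scl e UNIV) (M_fun scl e Y)"
      using assms(3) u by (simp add: self_similar_def Y_def)
    then obtain B where B: "B > 0"
      and ev: "eventually (\<lambda>n. 0 < M_fun scl e Y n \<and> M_fun scl e UNIV n \<le> B * M_fun scl e Y n) sequentially"
      using asymp_equiv_const_eventually_le[OF _ assms(4)] by metis
    \<comment> \<open>The final comparison is between \<open>Q * M\<close> and
      \<open>(C + C * (2 * B)) * M\<close>; the summand \<open>1\<close> makes it fail.\<close>
    define Q where "Q = C + C * (2 * B) + 1"
    obtain N0 where N0: "\<And>s t. s \<ge> 0 \<Longrightarrow> t \<ge> 0 \<Longrightarrow> \<bar>s - t\<bar> \<ge> N0 \<Longrightarrow> cmod (\<phi> s - \<phi> t) \<ge> Q"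
      using assms(5) unfolding expansive_def by meson
    \<comment> \<open>The factor \<open>2 * B\<close> pays for self-similarity and for reaching only
      half of the supremum, so that \<open>ln M\<close> will be at least \<open>N0\<close>. The
      maximum with \<open>0\<close> keeps the shift nonnegative.\<close>
    have "eventually (\<lambda>n. 2 * B * exp (max N0 0) \<le> M_fun scl e UNIV n) sequentially"
      using assms(4) by (simp add: filterlim_at_top)
    with ev have "eventually (\<lambda>n. 0 < M_fun scl e Y n \<and> M_fun scl e UNIV n \<le> B * M_fun scl e Y n \<and>
        2 * B * exp (max N0 0) \<le> M_fun scl e UNIV n) sequentially"
      by eventually_elim auto
    then obtain n where n: "0 < M_fun scl e Y n" "M_fun scl e UNIV n \<le> B * M_fun scl e Y n"
        "2 * B * exp (max N0 0) \<le> M_fun scl e UNIV n"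
      by (auto simp: eventually_sequentially)
    have "0 \<in> Y" unfolding Y_def using closure_subset subspace_0[OF subspace_span] by blast
    moreover have "M_fun scl e Y n / 2 < M_fun scl e Y n" using n(1) by simp
    ultimately obtain v where v: "\<And>i. i < n \<Longrightarrow> v i \<in> Y" "\<And>i. i < n \<Longrightarrow> norm (v i) \<le> 1"
      "disjoint_family_on (\<lambda>i. supp scl e (v i)) {..<n}" "M_fun scl e Y n / 2 < norm (\<Sum>i<n. v i)"
      by (rule M_fun_approx) (rule that, assumption+)
    \<comment> \<open>Cutting far out keeps more than half of the supremum; moving the cut from
      \<open>K\<close> to the block boundary \<open>p K \<ge> K\<close> cannot decrease the
      norm.\<close>
    have "(\<lambda>N. norm (trunc N (\<Sum>i<n. v i))) \<longlonglongrightarrow> norm (\<Sum>i<n. v i)"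
      by (intro tendsto_norm trunc_tendsto)
    then have "eventually (\<lambda>N. M_fun scl e Y n / 2 < norm (trunc N (\<Sum>i<n. v i))) sequentially"
      using v(4) by (rule order_tendstoD)
    then obtain K where "M_fun scl e Y n / 2 < norm (trunc K (\<Sum>i<n. v i))"
      by (auto simp: eventually_sequentially)
    also have "\<dots> \<le> norm (trunc (p K) (\<Sum>i<n. v i))"
      using seq_suble[OF p, of K] by (intro norm_mono) (auto simp: coord_trunc)
    also have "trunc (p K) (\<Sum>i<n. v i) = (\<Sum>i<n. trunc (p K) (v i))"
      by (rule coord_inject) (auto simp: coord_sum coord_trunc)
    finally have big: "M_fun scl e Y n / 2 < norm (\<Sum>i<n. trunc (p K) (v i))" .
    define x where "x i = trunc (p K) (v i)" for i
    define s where "s = (\<Sum>i<n. x i)"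
    define M where "M = norm s"
    have xS: "x i \<in> S K" if "i < n" for i
      using trunc_closure_span[of u p b "v i", OF _ b disj] v(1)[OF that] u
      by (auto simp: S_def x_def Y_def disjoint_sequence_def)
    have nx: "norm (x i) \<le> 1" if "i < n" for i
      using v(2)[OF that] norm_trunc_le[of "p K" "v i"] by (simp add: x_def)
    have dx: "co (x j) m = 0" if "co (x i) m \<noteq> 0" "i < n" "j < n" "i \<noteq> j" for i j m
      using that v(3) by (auto simp: x_def coord_trunc disjoint_family_on_def supp_def split: if_splits)
    have MX: "M_fun scl e UNIV n \<le> 2 * B * M"
    proof -
      have "B * M_fun scl e Y n \<le> B * (2 * M)"
        using big B by (intro mult_left_mono) (auto simp: M_def s_def x_def)
      with n(2) show ?thesis by simp
    qed
    with n(3) have "2 * B * exp (max N0 0) \<le> 2 * B * M" by linarith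
    then have expM: "exp (max N0 0) \<le> M" using B by simp
    then have Mpos: "M > 0" using exp_gt_zero less_le_trans by blast
    have lnM: "max N0 0 \<le> ln M" using expM by (simp only: ln_ge_iff[OF Mpos])
    obtain y where y: "\<And>i. i < n \<Longrightarrow> co (y i) = (\<lambda>m. kp \<phi> (co (x i) m) - g m * co (x i) m)"
        "\<And>i. i < n \<Longrightarrow> norm (y i) \<le> C"
    proof -
      have "\<forall>i. \<exists>z. i < n \<longrightarrow> co z = (\<lambda>m. kp \<phi> (co (x i) m) - g m * co (x i) m) \<and> norm z \<le> C"
        using C[OF xS nx] unfolding in_ball_def by blast
      then show ?thesis using that by metis
    qed
    \<comment> \<open>Both \<open>kp\<close> and the multiplier vanish at \<open>0\<close>, so
      \<open>y i\<close> lives on the support of \<open>x i\<close> and disjointness is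
      inherited.\<close>
    have ysum: "norm (\<Sum>i<n. y i) \<le> C * M_fun scl e UNIV n"
    proof (rule norm_sum_le_M_fun)
      show "disjoint_family_on (\<lambda>i. supp scl e (y i)) {..<n}"
        unfolding disjoint_family_on_def
      proof (intro ballI impI equals0I)
        fix i j m
        assume ij: "i \<in> {..<n}" "j \<in> {..<n}" "i \<noteq> j"
          and "m \<in> supp scl e (y i) \<inter> supp scl e (y j)"
        then have "co (x i) m \<noteq> 0" "co (x j) m \<noteq> 0" by (auto simp: supp_def y(1))
        with dx ij show False by auto
      qed
    qed (use y(2) in \<open>simp_all add: C_def\<close>)
    \<comment> \<open>The estimate is applied to the normalised sum and scaled back; the division by
      \<open>M\<close> is what shifts the logarithm by \<open>ln M\<close>.\<close>
    have "in_ball C (\<lambda>m. kp \<phi> (co (scl (of_real (1 / M)) s) m) - g m * co (scl (of_real (1 / M)) s) m)"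
    proof (rule C)
      show "scl (of_real (1 / M)) s \<in> S K"
        unfolding s_def using xS by (intro S_scl S_sum) auto
      show "norm (scl (of_real (1 / M)) s) \<le> 1"
        using Mpos by (simp add: norm_scl norm_divide M_def)
    qed
    then have "in_ball (M * C) (\<lambda>m. of_real M * (kp \<phi> (co s m / of_real M) - g m * (co s m / of_real M)))"
      using Mpos by (intro in_ball_scale) (auto simp: coord_scl)
    then have "in_ball (M * C + C * M_fun scl e UNIV n)
        (\<lambda>m. of_real M * (kp \<phi> (co s m / of_real M) - g m * (co s m / of_real M)) - co (\<Sum>i<n. y i) m)"
      using in_ball_coord[OF ysum] by (rule in_ball_diff)
    then have "in_ball (M * C + C * M_fun scl e UNIV n) (\<lambda>m. of_real Q * co s m)"
    proof (rule in_ball_mono[OF _ _ order_refl])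
      fix m
      show "cmod (of_real Q * co s m) \<le> cmod (of_real M * (kp \<phi> (co s m / of_real M) -
          g m * (co s m / of_real M)) - co (\<Sum>i<n. y i) m)"
      \<comment> \<open>At most one \<open>x j\<close> contributes at \<open>m\<close>, so the terms
        with \<open>g\<close> cancel and \<open>t\<close> times an increment of
        \<open>\<phi>\<close> over a step of \<open>ln M\<close> remains.\<close>
      proof (cases "\<exists>j<n. co (x j) m \<noteq> 0")
        case False
        then show ?thesis by (simp add: s_def coord_sum)
      next
        case True
        then obtain j where j: "j < n" "co (x j) m \<noteq> 0" by blast
        define t where "t = co (x j) m"
        have other: "co (x i) m = 0" if "i < n" "i \<noteq> j" for i using dx[OF j(2,1)] that by blast
        have st: "co s m = t"
          unfolding s_def coord_sum t_def using j(1) other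
          by (subst sum.remove[of _ j]) auto
        have yt: "co (\<Sum>i<n. y i) m = kp \<phi> t - g m * t"
          unfolding coord_sum t_def using j(1) other y(1)
          by (subst sum.remove[of _ j]) auto
        have t: "0 < cmod t" "cmod t \<le> 1"
          using j cmod_coord_le[of "x j" m] nx[OF j(1)] by (auto simp: t_def)
        have t0: "0 \<le> - ln (cmod t)" using t by simp
        have "ln (cmod (t / of_real M)) = ln (cmod t) - ln M"
          using t Mpos by (simp add: norm_divide ln_div)
        then have "max 0 (- ln (cmod (t / of_real M))) = - ln (cmod t) + ln M"
          using t0 lnM by linarith
        then have "kp \<phi> (t / of_real M) = t / of_real M * \<phi> (- ln (cmod t) + ln M)"
          by (simp only: kp_def)
        moreover have "kp \<phi> t = t * \<phi> (- ln (cmod t))" using t0 by (simp add: kp_def max_def)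
        ultimately have "of_real M * (kp \<phi> (t / of_real M) - g m * (t / of_real M)) - (kp \<phi> t - g m * t) =
            t * (\<phi> (- ln (cmod t) + ln M) - \<phi> (- ln (cmod t)))"
          using Mpos by (simp add: field_simps)
        moreover have "Q \<le> cmod (\<phi> (- ln (cmod t) + ln M) - \<phi> (- ln (cmod t)))"
          using t0 lnM by (intro N0) auto
        then have "Q * cmod t \<le> cmod (\<phi> (- ln (cmod t) + ln M) - \<phi> (- ln (cmod t))) * cmod t"
          by (intro mult_right_mono) auto
        moreover have "Q \<ge> 0" using B by (simp add: Q_def C_def)
        ultimately show ?thesis by (simp add: st yt norm_mult mult.commute)
      qed
    qed
    then obtain z where z: "co z = co (scl (of_real Q) s)" "norm z \<le> M * C + C * M_fun scl e UNIV n"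
      by (auto simp: in_ball_def coord_scl fun_eq_iff)
    have "z = scl (of_real Q) s" by (rule coord_inject) (simp add: z(1))
    moreover have "Q \<ge> 0" using B by (simp add: Q_def C_def)
    ultimately have "Q * M \<le> M * C + C * M_fun scl e UNIV n" using z(2) by (simp add: norm_scl M_def)
    also have "C * M_fun scl e UNIV n \<le> C * (2 * B * M)"
      using MX by (intro mult_left_mono) (auto simp: C_def)
    finally show False using Mpos by (simp add: Q_def algebra_simps)
  qed
  then show ?thesis unfolding singular_def by blast
qed

end
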